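(* For every $n$ there is a set of $n$ points (on a line) such that, in the symmetric bi-directional model, any set of pairs forming a connected graph on these points requires $\Omega(n)$ slots; i.e., it cannot be partitioned into fewer than $\Omega(n)$ sets each feasible in the symmetric bi-directional model.
   Context: Bi-directional model: a pair $\ell=\{n_1,n_2\}$ of points defines two links $\ell_1=(n_1,n_2)$ and $\ell_2=(n_2,n_1)$, each of length $d(n_1,n_2)$; for links $x=(s,r)$, $y=(s',r')$ write $d_{xy}=d(s,r')$. Constants $\alpha>2$, $\beta\ge1$; noise is neglected. A set $L'$ of pairs is feasible (schedulable in one slot) if there are powers $P_{\ell_1},P_{\ell_2}>0$ for each pair such that for every $\ell\in L'$ and $i\in\{1,2\}$: $\frac{P_{\ell_i}/\ell_i^\alpha}{\sum_{\ell'\in L'\setminus\{\ell\}}\sum_{k=1}^2P_{\ell'_k}/d_{\ell'_k\ell_i}^\alpha}\ge\beta$ (the two links of the same pair do not interfere with each other). In the symmetric model one additionally requires $P_{\ell_1}=P_{\ell_2}$ for every pair. *)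

theory Defs
  imports
    Complex_Main
    "HOL-Library.Extended_Nonnegative_Real"
    "HOL-Library.Landau_Symbols"
    "HOL-Library.Disjoint_Sets"
    "Graph_Theory.Digraph_Component"
begin

text \<open>A link is an ordered pair (sender, receiver).\<close>

type_synonym 'a link = "'a \<times> 'a"

definition pairs_on :: "'a set \<Rightarrow> 'a set set" where
  "pairs_on V = {{u, v} | u v. u \<in> V \<and> v \<in> V \<and> u \<noteq> v}"

definition links_of :: "'a set \<Rightarrow> 'a link set" where
  "links_of l = {(s, r). s \<noteq> r \<and> l = {s, r}}"

definition link_dist :: "'a::metric_space link \<Rightarrow> 'a link \<Rightarrow> real" where
  "link_dist x y = dist (fst x) (snd y)"

definition link_length :: "'a::metric_space link \<Rightarrow> real" where
  "link_length x = dist (fst x) (snd x)"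

text \<open>
  Quotients are taken in the extended nonnegative reals, where \<open>a / 0 = \<infinity>\<close> for \<open>a > 0\<close>
  and \<open>a / \<infinity> = 0\<close> for finite \<open>a\<close>. Hence an interfering sender located at a receiver
  (two distinct pairs sharing a point) causes infinite interference and makes the ratio 0,
  while a pair without any interference has ratio \<open>\<infinity>\<close>. With real division, where
  \<open>a / 0 = 0\<close>, both cases would come out wrong.
\<close>

definition interference ::
  "real \<Rightarrow> ('a::metric_space link \<Rightarrow> real) \<Rightarrow> 'a set set \<Rightarrow> 'a set \<Rightarrow> 'a link \<Rightarrow> ennreal" where
  "interference \<alpha> P L l x =
     (\<Sum>l' \<in> L - {l}. \<Sum>y \<in> links_of l'. ennreal (P y) / ennreal (link_dist y x powr \<alpha>))"

definition sir ::
  "real \<Rightarrow> ('a::metric_space link \<Rightarrow> real) \<Rightarrow> 'a set set \<Rightarrow> 'a set \<Rightarrow> 'a link \<Rightarrow> ennreal" where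
  "sir \<alpha> P L l x =
     (ennreal (P x) / ennreal (link_length x powr \<alpha>)) / interference \<alpha> P L l x"

definition feasible_with ::
  "real \<Rightarrow> real \<Rightarrow> ('a::metric_space link \<Rightarrow> real) \<Rightarrow> 'a set set \<Rightarrow> bool" where
  "feasible_with \<alpha> \<beta> P L \<longleftrightarrow>
     (\<forall>l \<in> L. \<forall>x \<in> links_of l. P x > 0 \<and> sir \<alpha> P L l x \<ge> ennreal \<beta>)"

definition symmetric_feasible :: "real \<Rightarrow> real \<Rightarrow> 'a::metric_space set set \<Rightarrow> bool" where
  "symmetric_feasible \<alpha> \<beta> L \<longleftrightarrow>
     (\<exists>P. (\<forall>l \<in> L. \<forall>(s, r) \<in> links_of l. P (s, r) = P (r, s)) \<and> feasible_with \<alpha> \<beta> P L)"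

text \<open>Connectivity is qualified because \<open>connected\<close> also denotes topological connectedness.\<close>

definition forms_connected_graph :: "'a set \<Rightarrow> 'a set set \<Rightarrow> bool" where
  "forms_connected_graph V E \<longleftrightarrow>
     E \<subseteq> pairs_on V \<and>
     Digraph_Component.connected
       (with_proj \<lparr> pverts = V, parcs = (\<Union>l \<in> E. links_of l) \<rparr>)"

end

theory Submission
  imports Defs
begin

text \<open>
  Take points \<open>x\<^sub>0 < x\<^sub>1 < \<dots>\<close> on the line whose gaps satisfy \<open>x\<^sub>n\<^sub>+\<^sub>1 - x\<^sub>n > x\<^sub>n\<^sup>2\<close>.
  Two pairs \<open>\<ell>, \<ell>'\<close> that are feasible together with symmetric powers \<open>P, P'\<close> satisfy
  \<open>P / |\<ell>|\<^sup>\<alpha> \<ge> P' / d\<^sup>\<alpha>\<close> and \<open>P' / |\<ell>'|\<^sup>\<alpha> \<ge> P / d\<^sup>\<alpha>\<close> for every distance \<open>d\<close> between an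
  endpoint of \<open>\<ell>\<close> and one of \<open>\<ell>'\<close>, so \<open>d\<^sup>2 \<ge> |\<ell>| |\<ell>'|\<close>. If \<open>x\<^sub>m\<^sub>+\<^sub>1\<close> is the rightmost of the
  four endpoints, then the left endpoints are within \<open>x\<^sub>m\<close> of each other, while one of the
  pairs is longer than \<open>x\<^sub>m\<^sup>2\<close> and the other has length at least 1. Hence no slot holds two
  pairs, and a connected graph on \<open>n\<close> points has at least \<open>n - 1\<close> of them.
\<close>

section \<open>Edges of connected graphs\<close>

lemma finite_pairs_on:
  assumes "finite V"
  shows "finite (pairs_on V)"
proof (rule finite_subset)
  show "pairs_on V \<subseteq> Pow V" by (auto simp: pairs_on_def)
qed (use assms in simp)

text \<open>Follow a walk from a point of \<open>S\<close> to a point outside it: at each stage the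
  vertex reached still lies in \<open>S\<close> or a crossing edge has already appeared.\<close>

lemma connected_graph_crossing_edge:
  assumes conn: "forms_connected_graph V E" and "S \<subset> V" "S \<noteq> {}"
  obtains u v where "{u, v} \<in> E" "u \<in> S" "v \<in> V - S"
proof -
  let ?G = "mk_symmetric (with_proj \<lparr> pverts = V, parcs = (\<Union>l \<in> E. links_of l) \<rparr>)"
  obtain a b where a: "a \<in> S" and b: "b \<in> V - S" using assms by blast
  have "strongly_connected (with_proj ?G)"
    using conn by (simp add: forms_connected_graph_def connected_def)
  then have "(a, b) \<in> rtrancl_on V (parcs ?G)"
    using a b \<open>S \<subset> V\<close> by (auto simp: strongly_connected_def reachable_def)
  then have "b \<in> S \<or> (\<exists>u v. {u, v} \<in> E \<and> u \<in> S \<and> v \<in> V - S)"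
  proof (induction b rule: rtrancl_on_induct)
    case base
    then show ?case using a by simp
  next
    case (step y z)
    \<comment> \<open>\<open>mk_symmetric\<close> only adds reversed arcs, and both orientations
      come from the same unordered pair.\<close>
    from step(2) have "{y, z} \<in> E"
      by (auto simp: parcs_mk_symmetric links_of_def insert_commute)
    with step show ?case by blast
  qed
  with b that show ?thesis by blast
qed

text \<open>Grow a vertex set one crossing edge at a time. The new edge has an endpoint outside the
  old set, so it has not been counted before.\<close>

lemma connected_graph_card_edges:
  assumes conn: "forms_connected_graph V E" and fin: "finite V"
  shows "card V - 1 \<le> card E"
proof -
  have finE: "finite E"
    using conn finite_pairs_on[OF fin] by (auto simp: forms_connected_graph_def intro: finite_subset)
  have "\<exists>S \<subseteq> V. card S = k \<and> k - 1 \<le> card {e \<in> E. e \<subseteq> S}" if "k \<le> card V" for k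
    using that
  proof (induction k)
    case 0
    then show ?case by (intro exI[of _ "{}"]) auto
  next
    case (Suc k)
    then obtain S where S: "S \<subseteq> V" "card S = k" "k - 1 \<le> card {e \<in> E. e \<subseteq> S}" by auto
    have finS: "finite S" using S(1) fin finite_subset by blast
    show ?case
    \<comment> \<open>No edge leaves the empty set, so the first vertex comes without one; the bound
      \<open>Suc 0 - 1 = 0\<close> allows this.\<close>
    proof (cases "k = 0")
      case True
      from Suc.prems obtain v where "v \<in> V" by fastforce
      with True show ?thesis by (intro exI[of _ "{v}"]) auto
    next
      case False
      have "S \<subset> V" "S \<noteq> {}" using S Suc.prems False by auto
      from connected_graph_crossing_edge[OF conn this]
      obtain u v where uv: "{u, v} \<in> E" "u \<in> S" "v \<in> V - S" by blast
      have "Suc (card {e \<in> E. e \<subseteq> S}) = card (insert {u, v} {e \<in> E. e \<subseteq> S})"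
        using finE uv by (subst card_insert_disjoint) auto
      also have "\<dots> \<le> card {e \<in> E. e \<subseteq> insert v S}"
        using finE uv by (intro card_mono) auto
      finally show ?thesis
        using S uv finS by (intro exI[of _ "insert v S"]) auto
    qed
  qed
  from this[of "card V"] obtain S where "card V - 1 \<le> card {e \<in> E. e \<subseteq> S}" by auto
  also have "\<dots> \<le> card E" using finE by (intro card_mono) auto
  finally show ?thesis .
qed

section \<open>Conflicting pairs\<close>

lemma finite_links_of: "finite (links_of l)"
proof (cases "\<exists>a b. l = {a, b}")
  case True
  then obtain a b where "l = {a, b}" by blast
  then have "links_of l \<subseteq> {a, b} \<times> {a, b}" by (auto simp: links_of_def)
  then show ?thesis by (rule finite_subset) simp
next
  case False
  then have "links_of l = {}" by (auto simp: links_of_def)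
  then show ?thesis by simp
qed

text \<open>Multiply by \<open>b\<close> when it is finite and nonzero. For \<open>b = 0\<close> the
  claim is trivial, and for \<open>b = top\<close> the quotient is 0.\<close>

lemma ennreal_le_of_one_le_divide:
  fixes a b :: ennreal
  assumes "1 \<le> a / b"
  shows "b \<le> a"
proof (cases "b = 0 \<or> b = top")
  case True
  then show ?thesis using assms by auto
next
  case False
  have "b * 1 \<le> b * (a / b)" using assms by (rule mult_left_mono) simp
  also have "\<dots> = a" using False by (simp add: ennreal_times_divide mult_divide_eq_ennreal mult.commute)
  finally show ?thesis by simp
qed

text \<open>The interference at \<open>x\<close> is at least any one of its terms, so for
  \<open>\<beta> \<ge> 1\<close> the signal dominates the contribution of \<open>y\<close> alone.
  Finiteness of \<open>L\<close> keeps the sum from taking its default value 0.\<close>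

lemma feasible_with_pairwise:
  assumes feas: "feasible_with \<alpha> \<beta> P L" and "\<beta> \<ge> 1" and fin: "finite L"
    and l: "l \<in> L" "x \<in> links_of l" and l': "l' \<in> L" "y \<in> links_of l'" and "l \<noteq> l'"
  shows "0 < link_dist y x"
    and "P y * link_length x powr \<alpha> \<le> P x * link_dist y x powr \<alpha>"
proof -
  have Px: "P x > 0" and Py: "P y > 0" and sir: "ennreal \<beta> \<le> sir \<alpha> P L l x"
    using feas l l' by (auto simp: feasible_with_def)
  have len: "link_length x powr \<alpha> > 0"
    using l by (auto simp: links_of_def link_length_def)
  have "1 \<le> ennreal \<beta>" using \<open>\<beta> \<ge> 1\<close> by simp
  then have "1 \<le> sir \<alpha> P L l x" using sir by (rule order_trans)
  then have "interference \<alpha> P L l x \<le> ennreal (P x) / ennreal (link_length x powr \<alpha>)"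
    unfolding sir_def by (rule ennreal_le_of_one_le_divide)
  moreover have "ennreal (P y) / ennreal (link_dist y x powr \<alpha>) \<le> interference \<alpha> P L l x"
  proof -
    have "ennreal (P y) / ennreal (link_dist y x powr \<alpha>)
        \<le> (\<Sum>y \<in> links_of l'. ennreal (P y) / ennreal (link_dist y x powr \<alpha>))"
      using l' finite_links_of by (intro member_le_sum) auto
    also have "\<dots> \<le> interference \<alpha> P L l x"
      unfolding interference_def using l' \<open>l \<noteq> l'\<close> fin
      by (intro member_le_sum) auto
    finally show ?thesis .
  qed
  ultimately have le: "ennreal (P y) / ennreal (link_dist y x powr \<alpha>)
      \<le> ennreal (P x / link_length x powr \<alpha>)"
    using len Px by (simp add: divide_ennreal)
  \<comment> \<open>A sender at the receiver would contribute \<open>top\<close>, but the signal is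
    finite.\<close>
  show pos: "0 < link_dist y x"
  proof (rule ccontr)
    assume "\<not> 0 < link_dist y x"
    then have "link_dist y x = 0" by (simp add: link_dist_def)
    then show False using le Py by (simp add: top_unique)
  qed
  have "P y / link_dist y x powr \<alpha> \<le> P x / link_length x powr \<alpha>"
    using le pos Px Py len by (simp add: divide_ennreal)
  then show "P y * link_length x powr \<alpha> \<le> P x * link_dist y x powr \<alpha>"
    using pos len by (simp add: field_simps)
qed

text \<open>\<open>c\<close> disturbs reception at \<open>a\<close>, and \<open>a\<close> disturbs
  reception at \<open>c\<close>, over the same distance. As both directions of a pair use equal
  power, the powers cancel in the product of the two inequalities.\<close>

lemma symmetric_feasible_dist:
  fixes a b c d :: "'a::metric_space"
  assumes feas: "symmetric_feasible \<alpha> \<beta> L" and "\<alpha> > 0" "\<beta> \<ge> 1" "finite L"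
    and ab: "{a, b} \<in> L" "a \<noteq> b" and cd: "{c, d} \<in> L" "c \<noteq> d" and ne: "{a, b} \<noteq> {c, d}"
  shows "dist a b * dist c d \<le> (dist a c)\<^sup>2"
proof -
  obtain P where sym: "\<forall>l \<in> L. \<forall>(s, r) \<in> links_of l. P (s, r) = P (r, s)"
    and P: "feasible_with \<alpha> \<beta> P L"
    using feas by (auto simp: symmetric_feasible_def)
  have links: "(a, b) \<in> links_of {a, b}" "(b, a) \<in> links_of {a, b}"
      "(c, d) \<in> links_of {c, d}" "(d, c) \<in> links_of {c, d}"
    using ab cd by (auto simp: links_of_def)
  let ?p = "P (a, b)" and ?q = "P (c, d)"
  have swap: "P (b, a) = ?p" "P (d, c) = ?q"
    using bspec[OF bspec[OF sym ab(1)] links(1)] bspec[OF bspec[OF sym cd(1)] links(3)] by simp_all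
  have pos: "?p > 0" "?q > 0"
    using P ab(1) cd(1) links by (auto simp: feasible_with_def)
  define A B D where "A = dist a b powr \<alpha>" and "B = dist c d powr \<alpha>" and "D = dist a c powr \<alpha>"
  have nonneg: "0 \<le> A" "0 \<le> B" "0 \<le> D" by (simp_all add: A_def B_def D_def)
  note pair = feasible_with_pairwise(2)[OF P \<open>\<beta> \<ge> 1\<close> \<open>finite L\<close>]
  \<comment> \<open>Reception at \<open>a\<close> belongs to the link \<open>(b, a)\<close>, whose
    power is \<open>?p\<close> by symmetry.\<close>
  have 1: "?q * A \<le> ?p * D"
    using pair[OF ab(1) links(2) cd(1) links(3) ne] swap
    by (simp add: A_def D_def link_dist_def link_length_def dist_commute)
  have 2: "?p * B \<le> ?q * D"
    using pair[OF cd(1) links(4) ab(1) links(1) ne[symmetric]] swap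
    by (simp add: B_def D_def link_dist_def link_length_def dist_commute)
  have "(?p * ?q) * (A * B) = (?q * A) * (?p * B)" by simp
  also have "\<dots> \<le> (?p * D) * (?q * D)"
    by (rule mult_mono[OF 1 2]) (use pos nonneg in auto)
  also have "\<dots> = (?p * ?q) * (D * D)" by simp
  finally have "A * B \<le> D * D" using pos by simp
  then have "(dist a b * dist c d) powr \<alpha> \<le> ((dist a c)\<^sup>2) powr \<alpha>"
    by (simp add: A_def B_def D_def powr_mult power2_eq_square)
  then show ?thesis
    using \<open>\<alpha> > 0\<close> powr_less_mono2[of \<alpha> "(dist a c)\<^sup>2" "dist a b * dist c d"] by force
qed

section \<open>Points with rapidly growing gaps\<close>

text \<open>The square makes each gap outweigh squared distances between earlier points; the added 1
  makes this strict and keeps all gaps at least 1.\<close>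

fun sparse_point :: "nat \<Rightarrow> real" where
  "sparse_point 0 = 0"
| "sparse_point (Suc n) = (sparse_point n)\<^sup>2 + sparse_point n + 1"

lemma sparse_point_nonneg: "0 \<le> sparse_point n"
  by (induction n) auto

lemma strict_mono_sparse_point: "strict_mono sparse_point"
  by (rule strict_mono_Suc_iff[THEN iffD2]) (auto intro: add_nonneg_pos)

lemmas sparse_point_le = strict_mono_less_eq[OF strict_mono_sparse_point]

lemma sparse_point_gap:
  assumes "i \<le> n" "n < j"
  shows "sparse_point j - sparse_point i \<ge> (sparse_point n)\<^sup>2 + 1"
proof -
  have "sparse_point (Suc n) \<le> sparse_point j" "sparse_point i \<le> sparse_point n"
    using assms by (auto simp: sparse_point_le simp del: sparse_point.simps)
  then show ?thesis by simp
qed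

lemma sparse_point_conflict:
  assumes ij: "i < j" and kl: "k < l"
  shows "(dist (sparse_point i) (sparse_point k))\<^sup>2
    < dist (sparse_point i) (sparse_point j) * dist (sparse_point k) (sparse_point l)"
  using assms
\<comment> \<open>The claim is invariant under exchanging the pairs, so assume
  \<open>j \<le> l\<close>. Then both left indices are below \<open>l\<close>.\<close>
proof (induction j l arbitrary: i k rule: linorder_wlog)
  case (le j l)
  let ?x = sparse_point
  obtain m where l: "l = Suc m" using le.prems by (cases l) auto
  have "\<bar>?x i - ?x k\<bar> \<le> ?x m"
  proof -
    have "?x i \<le> ?x m" "?x k \<le> ?x m" using le l by (auto simp: sparse_point_le)
    then show ?thesis using sparse_point_nonneg[of i] sparse_point_nonneg[of k] by linarith
  qed
  then have "(dist (?x i) (?x k))\<^sup>2 \<le> (?x m)\<^sup>2"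
    unfolding dist_real_def by (intro power_mono) auto
  also have "\<dots> < dist (?x k) (?x l)"
    using sparse_point_gap[of k m l] le.prems l unfolding dist_real_def by auto
  also have "\<dots> \<le> dist (?x i) (?x j) * dist (?x k) (?x l)"
  proof -
    have "1 \<le> dist (?x i) (?x j)"
      using sparse_point_gap[of i i j] le.prems zero_le_power2[of "?x i"]
      unfolding dist_real_def by linarith
    then show ?thesis using mult_right_mono[of 1 "dist (?x i) (?x j)"] by fastforce
  qed
  finally show ?case .
next
  case (sym j l)
  from sym(1)[OF sym(3,2)] show ?case by (simp add: dist_commute mult.commute)
qed

lemma pairs_on_sparse_points:
  assumes "e \<in> pairs_on (sparse_point ` I)"
  obtains i j where "i < j" "e = {sparse_point i, sparse_point j}"
proof -
  from assms obtain i j where e: "e = {sparse_point i, sparse_point j}" "i \<noteq> j"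
    by (auto simp: pairs_on_def)
  show ?thesis
  proof (cases "i < j")
    case True
    with e that show ?thesis by blast
  next
    case False
    with e that[of j i] show ?thesis by (auto simp: insert_commute)
  qed
qed

lemma symmetric_feasible_sparse_points:
  assumes L: "L \<subseteq> pairs_on (sparse_point ` I)" "finite L"
    and feas: "symmetric_feasible \<alpha> \<beta> L" and "\<alpha> > 0" "\<beta> \<ge> 1"
  shows "card L \<le> 1"
proof -
  have "e = f" if "e \<in> L" "f \<in> L" for e f
  proof (rule ccontr)
    assume "e \<noteq> f"
    obtain i j where e: "i < j" "e = {sparse_point i, sparse_point j}"
      by (rule pairs_on_sparse_points[OF subsetD[OF L(1) \<open>e \<in> L\<close>]])
    obtain k l where f: "k < l" "f = {sparse_point k, sparse_point l}"
      by (rule pairs_on_sparse_points[OF subsetD[OF L(1) \<open>f \<in> L\<close>]])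
    have "sparse_point i \<noteq> sparse_point j" "sparse_point k \<noteq> sparse_point l"
      using e(1) f(1) by (simp_all add: strict_mono_eq[OF strict_mono_sparse_point])
    \<comment> \<open>The left endpoints take the roles of \<open>a\<close> and
      \<open>c\<close>.\<close>
    then have "dist (sparse_point i) (sparse_point j) * dist (sparse_point k) (sparse_point l)
        \<le> (dist (sparse_point i) (sparse_point k))\<^sup>2"
      using that \<open>e \<noteq> f\<close> unfolding e(2) f(2)
      by (intro symmetric_feasible_dist[OF feas \<open>\<alpha> > 0\<close> \<open>\<beta> \<ge> 1\<close> \<open>finite L\<close>])
    with sparse_point_conflict[OF e(1) f(1)] show False by simp
  qed
  then show ?thesis using \<open>finite L\<close> by (simp add: card_le_Suc0_iff_eq)
qed

theorem theorem4:
  fixes \<alpha> \<beta> :: real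
  assumes "\<alpha> > 2" and "\<beta> \<ge> 1"
  shows "\<exists>T :: nat \<Rightarrow> nat. (\<lambda>n. real (T n)) \<in> \<Omega>(\<lambda>n. real n) \<and>
    (\<forall>n. \<exists>V :: real set. finite V \<and> card V = n \<and>
      (\<forall>E \<S>. forms_connected_graph V E \<and> partition_on E \<S> \<and>
               (\<forall>L \<in> \<S>. symmetric_feasible \<alpha> \<beta> L)
             \<longrightarrow> T n \<le> card \<S>))"
proof (intro exI[of _ "\<lambda>n. n - 1"] conjI allI)
  show "(\<lambda>n. real (n - 1)) \<in> \<Omega>(\<lambda>n. real n)"
    \<comment> \<open>The constant works because \<open>n - 1 \<ge> n / 2\<close> once
      \<open>n \<ge> 2\<close>.\<close>
    by (rule landau_omega.bigI[of "1/2"])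
      (auto intro!: eventually_mono[OF eventually_ge_at_top[of 2]])
next
  fix n :: nat
  let ?V = "sparse_point ` {..<n}"
  have card_V: "card ?V = n"
    using strict_mono_imp_inj_on[OF strict_mono_sparse_point]
    by (subst card_image) (auto intro: inj_on_subset)
  have "n - 1 \<le> card \<S>"
    if conn: "forms_connected_graph ?V E" and part: "partition_on E \<S>"
      and feas: "\<forall>L \<in> \<S>. symmetric_feasible \<alpha> \<beta> L" for E \<S>
  proof -
    have E: "E \<subseteq> pairs_on ?V" using conn by (simp add: forms_connected_graph_def)
    then have "finite E" using finite_pairs_on finite_subset by blast
    have block: "card L \<le> 1" if "L \<in> \<S>" for L
    proof (rule symmetric_feasible_sparse_points)
      have "L \<subseteq> E" using that part by (auto simp: partition_on_def)
      then show "L \<subseteq> pairs_on ?V" "finite L"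
        using E \<open>finite E\<close> finite_subset by blast+
    qed (use that feas assms in auto)
    \<comment> \<open>Each block holds at most one edge, so there are at least as many blocks as
      edges.\<close>
    have "n - 1 \<le> card E" using connected_graph_card_edges[OF conn] card_V by simp
    also have "\<dots> = card (\<Union>\<S>)" using part by (simp add: partition_on_def)
    also have "\<dots> \<le> (\<Sum>L \<in> \<S>. card L)" by (rule card_Union_le_sum_card)
    also have "\<dots> \<le> card \<S>" using sum_mono[of \<S> card "\<lambda>_. 1"] block by simp
    finally show ?thesis .
  qed
  with card_V show "\<exists>V :: real set. finite V \<and> card V = n \<and>
      (\<forall>E \<S>. forms_connected_graph V E \<and> partition_on E \<S> \<and>
               (\<forall>L \<in> \<S>. symmetric_feasible \<alpha> \<beta> L)
             \<longrightarrow> n - 1 \<le> card \<S>)"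
    by (intro exI[of _ ?V]) auto
qed

end
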